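(* Let $N\geq n\geq 2$ be integers, let $w=(w_1,\dots,w_n)\in\mathbb{R}^n$ be a fixed vector, and let $X_1,\dots,X_N\in[-1,1]$ be exchangeable random variables. Let $\bar X=\frac1N\sum_{i=1}^N X_i$, $\sigma_X^2=\frac1N\sum_{i=1}^N(X_i-\bar X)^2$, $H_N=1+\frac12+\dots+\frac1N$, $\epsilon_N=\frac{H_N-1}{N-H_N}$, and $\tilde\sigma_{X,N}^2=\sigma_X^2+4\epsilon_N$ (with $\tilde\sigma_{X,N}\geq 0$ its square root). Then for any $\lambda\in\mathbb{R}$ with $|\lambda|<\frac{3}{2\|w\|_\infty(1+\epsilon_N)}$, \[\mathbb{E}\left[\exp\left\{\lambda\sum_{i=1}^n w_i(X_i-\bar X)-\frac{\lambda^2(1+\epsilon_N)}{2\left(1-\frac{2|\lambda|}{3}\|w\|_\infty(1+\epsilon_N)\right)}\cdot\tilde\sigma_{X,N}^2\,\|w\|_2^2\right\}\right]\leq 1.\] Consequently, for any $\delta\in(0,1)$, \[\mathbb{P}\left\{\sum_{i=1}^n w_i(X_i-\bar X)\geq \tilde\sigma_{X,N}\|w\|_2\sqrt{2(1+\epsilon_N)\log(1/\delta)}+\frac23\|w\|_\infty(1+\epsilon_N)\log(1/\delta)\right\}\leq\delta.\]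
   Context: Random variables $X_1,\dots,X_N$ are exchangeable if the joint distribution of $(X_1,\dots,X_N)$ equals that of $(X_{\pi(1)},\dots,X_{\pi(N)})$ for every permutation $\pi$ of $\{1,\dots,N\}$. $\|w\|_2=(\sum_{i=1}^n w_i^2)^{1/2}$ and $\|w\|_\infty=\max_{1\leq i\leq n}|w_i|$. The quantities $\bar X$, $\sigma_X^2$ and $\tilde\sigma_{X,N}^2$ are computed from all $N$ variables and are random variables.
   Formalization: The tail bound is stated for w ≠ 0 only: for w = 0 the event is {0 ≥ 0}, which has probability 1 > δ. In the first bound, for w = 0, the condition on λ is read as no restriction. *)

theory Defs
  imports "HOL-Probability.Probability" "HOL-Combinatorics.Permutations"
begin

text \<open>The joint law is taken on the product sigma-algebra over \<open>I\<close>. The definition is meant for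
  families of random variables, as \<open>distr\<close> is degenerate for non-measurable maps.\<close>

definition exchangeable :: "'a measure \<Rightarrow> 'i set \<Rightarrow> ('i \<Rightarrow> 'a \<Rightarrow> real) \<Rightarrow> bool" where
  "exchangeable M I X \<longleftrightarrow>
     (\<forall>\<pi>. \<pi> permutes I \<longrightarrow>
        distr M (\<Pi>\<^sub>M i\<in>I. borel) (\<lambda>\<omega>. \<lambda>i\<in>I. X (\<pi> i) \<omega>)
          = distr M (\<Pi>\<^sub>M i\<in>I. borel) (\<lambda>\<omega>. \<lambda>i\<in>I. X i \<omega>))"

text \<open>Vectors in \<open>\<real>\<^sup>n\<close> are functions on \<open>nat\<close>, of which only the values at \<open>1, \<dots>, n\<close> matter.
  The Euclidean norm of such a vector \<open>w\<close> is \<open>L2_set w {1..n}\<close>.\<close>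

definition max_norm :: "nat \<Rightarrow> (nat \<Rightarrow> real) \<Rightarrow> real" where
  "max_norm n w = (MAX i\<in>{1..n}. \<bar>w i\<bar>)"

definition mean :: "nat \<Rightarrow> (nat \<Rightarrow> real) \<Rightarrow> real" where
  "mean N x = (\<Sum>i=1..N. x i) / real N"

definition pvar :: "nat \<Rightarrow> (nat \<Rightarrow> real) \<Rightarrow> real" where
  "pvar N x = (\<Sum>i=1..N. (x i - mean N x)\<^sup>2) / real N"

definition eps :: "nat \<Rightarrow> real" where
  "eps N = (harm N - 1) / (real N - harm N)"

definition sd_infl :: "nat \<Rightarrow> (nat \<Rightarrow> real) \<Rightarrow> real" where
  "sd_infl N x = sqrt (pvar N x + 4 * eps N)"

end

theory Submission
  imports Defs
begin

text \<open>
  By exchangeability, both claims follow from their counterparts for a fixed population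
  \<open>x\<^sub>1, \<dots>, x\<^sub>N \<in> [-1, 1]\<close> in uniformly random order, with all probabilities replaced by averages over
  permutations (\<open>expectation_exchangeable_le\<close>). This matters for the tail bound, where the optimal
  parameter of the Chernoff bound depends on the variance: the variance is random for the \<open>X i\<close>, but
  fixed for a given population.

  For a population in random order, draw the values without replacement, starting with the last
  position. Given the later values, the one in position \<open>k\<close> is uniform on those that are left,
  which occupy the first \<open>k\<close> positions. Its deviation from their mean is thus a martingale difference,
  and Bernstein's bound for one draw makes
  \<open>exp (\<Sum>k. a v\<^sub>k (y\<^sub>k - mean k y) - c v\<^sub>k\<^sup>2 pvar k y)\<close> a supermartingale
  (\<open>prefix_exponent_Bernstein\<close>).

  The sum of interest is centred at the mean of the whole population instead. The idea that connects
  the two is to reorder values and weights together at random: averaged over such reorderings,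
  the martingale sum equals the centred weighted sum divided by \<open>1 + eps N\<close>
  (\<open>sum_perm_avg_prefix_deviation\<close>), and the sum of the conditional variances is at most
  \<open>(\<sigma>\<^sup>2 + 4 eps N) \<parallel>w\<parallel>\<^sup>2 / (1 + eps N)\<close> (\<open>sum_perm_avg_prefix_pvar\<close>). The harmonic number in
  \<open>eps N\<close> is the sum over \<open>k\<close> of the weight \<open>1 / k\<close> that \<open>y\<^sub>k\<close> has in the mean of its own prefix.
  Jensen's inequality then bounds the exponential of the centred sum by an average of exponentials
  of martingale sums, each of which has mean at most 1 (\<open>perm_avg_Bernstein\<close>).
\<close>

section \<open>Averages over permutations\<close>

definition perm_avg :: "'i set \<Rightarrow> (('i \<Rightarrow> 'i) \<Rightarrow> real) \<Rightarrow> real" where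
  "perm_avg I F = (\<Sum>p | p permutes I. F p) / fact (card I)"

lemma perm_avg_mono:
  assumes "\<And>p. p permutes I \<Longrightarrow> F p \<le> G p"
  shows "perm_avg I F \<le> perm_avg I G"
  unfolding perm_avg_def by (intro divide_right_mono sum_mono) (use assms in auto)

lemma perm_avg_cong:
  assumes "\<And>p. p permutes I \<Longrightarrow> F p = G p"
  shows "perm_avg I F = perm_avg I G"
  unfolding perm_avg_def by (intro arg_cong2[where f = "(/)"] sum.cong) (use assms in auto)

lemma perm_avg_const: "finite I \<Longrightarrow> perm_avg I (\<lambda>_. c) = c"
  by (simp add: perm_avg_def card_permutations)

lemma perm_avg_add: "perm_avg I (\<lambda>p. F p + G p) = perm_avg I F + perm_avg I G"
  by (simp add: perm_avg_def sum.distrib add_divide_distrib)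

lemma perm_avg_diff: "perm_avg I (\<lambda>p. F p - G p) = perm_avg I F - perm_avg I G"
  by (simp add: perm_avg_def sum_subtractf diff_divide_distrib)

lemma perm_avg_cmult: "perm_avg I (\<lambda>p. c * F p) = c * perm_avg I F"
  by (simp add: perm_avg_def sum_distrib_left)

lemma perm_avg_sum: "perm_avg I (\<lambda>p. \<Sum>k\<in>A. F k p) = (\<Sum>k\<in>A. perm_avg I (F k))"
  unfolding perm_avg_def by (subst sum.swap) (simp add: sum_divide_distrib)

lemma perm_avg_swap:
  "perm_avg I (\<lambda>p. perm_avg J (F p)) = perm_avg J (\<lambda>q. perm_avg I (\<lambda>p. F p q))"
  unfolding perm_avg_def sum_divide_distrib[symmetric]
  by (subst sum.swap) (simp add: field_simps)

lemma perm_avg_compose: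
  assumes "q permutes I"
  shows "perm_avg I (\<lambda>p. F (p \<circ> q)) = perm_avg I F"
  unfolding perm_avg_def by (subst sum_permutations_compose_right[OF assms, of F]) simp

text \<open>
  Jensen's inequality for the exponential function, obtained by averaging the tangent at \<open>m\<close>.
  The hypothesis on \<open>m\<close> is an inequality so that the mean of the exponent only has to be estimated
  from below.
\<close>

lemma exp_perm_avg_le:
  assumes "finite I" "m \<le> perm_avg I F"
  shows "exp m \<le> perm_avg I (\<lambda>p. exp (F p))"
proof -
  have tangent: "exp m * (1 + (F p - m)) \<le> exp (F p)" for p
    using mult_left_mono[OF exp_ge_add_one_self[of "F p - m"], of "exp m"]
    by (simp flip: exp_add)
  have "exp m \<le> exp m * (1 + (perm_avg I F - m))"
    using assms(2) by simp
  also have "\<dots> = perm_avg I (\<lambda>p. exp m * (1 + (F p - m)))"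
    by (simp add: perm_avg_cmult perm_avg_add perm_avg_diff perm_avg_const assms(1))
  also have "\<dots> \<le> perm_avg I (\<lambda>p. exp (F p))"
    by (intro perm_avg_mono tangent)
  finally show ?thesis .
qed

text \<open>
  A transposition shows that the average is the same for every position \<open>k\<close>, and its sum over all
  positions is the constant sum of \<open>g\<close>. The joint law of two positions below comes from the same
  symmetry: with \<open>p k\<close> kept in place, all other positions \<open>j\<close> are interchangeable, and together with
  position \<open>k\<close> they exhaust the sum of \<open>h\<close>.
\<close>

lemma perm_avg_eval:
  assumes "finite I" "k \<in> I"
  shows "perm_avg I (\<lambda>p. g (p k)) = (\<Sum>i\<in>I. g i) / card I"
proof -
  have same: "perm_avg I (\<lambda>p. g (p i)) = perm_avg I (\<lambda>p. g (p k))" if "i \<in> I" for i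
    using perm_avg_compose[OF permutes_swap_id[OF that assms(2)], of "\<lambda>p. g (p k)"]
    by (simp add: comp_def)
  have "card I * perm_avg I (\<lambda>p. g (p k)) = (\<Sum>i\<in>I. perm_avg I (\<lambda>p. g (p i)))"
    by (simp add: same)
  also have "\<dots> = perm_avg I (\<lambda>p. \<Sum>i\<in>I. g (p i))"
    by (simp add: perm_avg_sum)
  also have "\<dots> = perm_avg I (\<lambda>_. \<Sum>i\<in>I. g i)"
    by (intro perm_avg_cong) (metis permutes_imp_bij sum.reindex_bij_betw)
  also have "\<dots> = (\<Sum>i\<in>I. g i)"
    by (simp add: perm_avg_const assms(1))
  finally show ?thesis
    using assms by (metis card_0_eq empty_iff nonzero_mult_div_cancel_left of_nat_eq_0_iff)
qed

lemma perm_avg_eval_two: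
  fixes g h :: "'i \<Rightarrow> real"
  assumes "finite I" "k \<in> I" "j \<in> I" "j \<noteq> k"
  shows "perm_avg I (\<lambda>p. g (p k) * h (p j)) =
    ((\<Sum>i\<in>I. g i) * (\<Sum>i\<in>I. h i) - (\<Sum>i\<in>I. g i * h i)) / (real (card I) * (real (card I) - 1))"
proof -
  let ?E = "\<lambda>i. perm_avg I (\<lambda>p. g (p k) * h (p i))"
  have same: "?E i = ?E j" if "i \<in> I - {k}" for i
  proof -
    have "Transposition.transpose i j k = k"
      using that assms by auto
    moreover have "Transposition.transpose i j permutes I"
      using that assms by (intro permutes_swap_id) auto
    ultimately show ?thesis
      using perm_avg_compose[of "Transposition.transpose i j" I "\<lambda>p. g (p k) * h (p j)"] by simp
  qed
  have card: "real (card I) - 1 > 0"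
    using card_mono[OF assms(1), of "{k, j}"] assms by auto
  have "real (card (I - {k})) = real (card I) - 1"
    using card assms by (subst card_Diff_singleton) (auto simp: of_nat_diff)
  then have "(real (card I) - 1) * ?E j = (\<Sum>i\<in>I - {k}. ?E j)"
    by simp
  also have "\<dots> = (\<Sum>i\<in>I - {k}. ?E i)"
    by (intro sum.cong refl same[symmetric])
  also have "\<dots> = (\<Sum>i\<in>I. ?E i) - ?E k"
    using assms by (simp add: sum_diff1)
  also have "(\<Sum>i\<in>I. ?E i) = perm_avg I (\<lambda>p. g (p k) * (\<Sum>i\<in>I. h (p i)))"
    by (simp add: perm_avg_sum sum_distrib_left)
  also have "\<dots> = perm_avg I (\<lambda>p. g (p k) * (\<Sum>i\<in>I. h i))"
    by (intro perm_avg_cong) (metis permutes_imp_bij sum.reindex_bij_betw)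
  also have "\<dots> = (\<Sum>i\<in>I. g i) * (\<Sum>i\<in>I. h i) / card I"
    using perm_avg_cmult[of I "sum h I" "\<lambda>p. g (p k)"] perm_avg_eval[OF assms(1,2), of g]
    by (simp add: mult.commute)
  also have "?E k = (\<Sum>i\<in>I. g i * h i) / card I"
    by (rule perm_avg_eval[OF assms(1,2), of "\<lambda>i. g i * h i"])
  finally show ?thesis
    using card by (simp add: field_simps)
qed

section \<open>Bernstein's bound for one draw\<close>

text \<open>
  In the exponential series \<open>(n + 2)! \<ge> 2 \<cdot> 3\<^sup>n\<close>, so the terms from the quadratic one on are dominated
  by a geometric series of ratio \<open>b / 3\<close>.
\<close>

lemma exp_Bernstein:
  fixes u b :: real
  assumes "\<bar>u\<bar> \<le> b" "b < 3"
  shows "exp u \<le> 1 + u + u\<^sup>2 / (2 * (1 - b / 3))"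
proof -
  have b: "0 \<le> b" "norm (b / 3) < 1"
    using assms by auto
  have fact_ge: "2 * 3 ^ n \<le> (fact (n + 2) :: real)" for n
  proof (induction n)
    case (Suc n)
    have "2 * 3 ^ Suc n \<le> real (n + 3) * (2 * 3 ^ n)"
      by (auto intro!: mult_right_mono)
    also have "\<dots> \<le> real (n + 3) * fact (n + 2)"
      by (intro mult_left_mono Suc) auto
    also have "\<dots> = fact (Suc n + 2)"
      by (simp add: algebra_simps)
    finally show ?case .
  qed simp
  have "inverse (fact (n + 2)) *\<^sub>R u ^ (n + 2) \<le> u\<^sup>2 / 2 * (b / 3) ^ n" for n
  proof -
    have "inverse (fact (n + 2)) *\<^sub>R u ^ (n + 2) \<le> inverse (fact (n + 2)) * (u\<^sup>2 * \<bar>u\<bar> ^ n)"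
      unfolding power_add[of u n 2] real_scaleR_def mult.commute[of "u ^ n"]
      by (intro mult_left_mono) (auto simp: power_abs[symmetric])
    also have "\<dots> \<le> inverse (2 * 3 ^ n) * (u\<^sup>2 * b ^ n)"
    proof (rule mult_mono)
      have "\<bar>u\<bar> ^ n \<le> b ^ n"
        using assms by (intro power_mono) auto
      then show "u\<^sup>2 * \<bar>u\<bar> ^ n \<le> u\<^sup>2 * b ^ n"
        by (intro mult_left_mono) auto
      show "inverse (fact (n + 2)) \<le> (inverse (2 * 3 ^ n) :: real)"
        using fact_ge[of n] by (rule le_imp_inverse_le) simp
    qed auto
    also have "\<dots> = u\<^sup>2 / 2 * (b / 3) ^ n"
      by (simp add: field_simps)
    finally show ?thesis .
  qed
  then have "(\<Sum>n. inverse (fact (n + 2)) *\<^sub>R u ^ (n + 2)) \<le> (\<Sum>n. u\<^sup>2 / 2 * (b / 3) ^ n)"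
    using b summable_ignore_initial_segment[OF summable_exp_generic[of u], of 2]
    by (intro suminf_le summable_mult summable_geometric) auto
  also have "\<dots> = u\<^sup>2 / (2 * (1 - b / 3))"
    unfolding suminf_mult[OF summable_geometric[OF b(2)]] suminf_geometric[OF b(2)] by simp
  finally show ?thesis
    by (simp add: exp_first_two_terms[of u])
qed

lemma sum_diff_mean:
  assumes "1 \<le> K"
  shows "(\<Sum>i=1..K. y i - mean K y) = 0"
  using assms by (simp add: mean_def sum_subtractf)

lemma abs_mean_le_one:
  assumes "1 \<le> K" "\<And>i. i \<in> {1..K} \<Longrightarrow> y i \<in> {-1..1}"
  shows "\<bar>mean K y\<bar> \<le> 1"
proof -
  have "\<bar>\<Sum>i=1..K. y i\<bar> \<le> (\<Sum>i=1..K. 1)"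
    using assms(2) by (intro order_trans[OF sum_abs] sum_mono) fastforce
  then show ?thesis
    using assms(1) by (simp add: mean_def)
qed

text \<open>
  One uniform draw from a population in \<open>[-1, 1]\<close> deviates from the population mean by at most 2,
  whence the constant \<open>2 / 3\<close>. The linear term of \<open>exp_Bernstein\<close> averages to zero and the quadratic
  one gives the variance.
\<close>

lemma one_draw_Bernstein:
  fixes y :: "nat \<Rightarrow> real" and a v B :: real
  assumes K: "1 \<le> K" and y: "\<And>i. i \<in> {1..K} \<Longrightarrow> y i \<in> {-1..1}"
    and v: "\<bar>v\<bar> \<le> B" and aB: "2 * \<bar>a\<bar> * B / 3 < 1"
  shows "(\<Sum>b=1..K. exp (a * v * (y b - mean K y) -
            a\<^sup>2 / (2 * (1 - 2 * \<bar>a\<bar> * B / 3)) * v\<^sup>2 * pvar K y)) \<le> real K"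
proof -
  define q where "q = v\<^sup>2 * a\<^sup>2 / (2 * (1 - 2 * \<bar>a\<bar> * B / 3))"
  have mean: "\<bar>mean K y\<bar> \<le> 1"
    using K y by (rule abs_mean_le_one)
  have bound: "\<bar>a * v * (y b - mean K y)\<bar> \<le> 2 * \<bar>a\<bar> * B" if "b \<in> {1..K}" for b
  proof -
    have "\<bar>a\<bar> * \<bar>v\<bar> * \<bar>y b - mean K y\<bar> \<le> \<bar>a\<bar> * B * 2"
      using y[OF that] mean v by (intro mult_mono) auto
    then show ?thesis
      by (simp add: abs_mult)
  qed
  have "(\<Sum>b=1..K. exp (a * v * (y b - mean K y))) \<le>
      (\<Sum>b=1..K. 1 + a * v * (y b - mean K y) +
         (a * v * (y b - mean K y))\<^sup>2 / (2 * (1 - 2 * \<bar>a\<bar> * B / 3)))"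
    using bound aB by (intro sum_mono exp_Bernstein) auto
  also have "\<dots> = real K + a * v * (\<Sum>b=1..K. y b - mean K y) + q * (\<Sum>b=1..K. (y b - mean K y)\<^sup>2)"
    by (simp add: sum.distrib sum_distrib_left sum_divide_distrib q_def power_mult_distrib mult_ac)
  also have "\<dots> = real K * (1 + q * pvar K y)"
    unfolding sum_diff_mean[OF K] using K by (simp add: pvar_def field_simps)
  also have "\<dots> \<le> real K * exp (q * pvar K y)"
    by (intro mult_left_mono exp_ge_add_one_self) auto
  finally have draw: "(\<Sum>b=1..K. exp (a * v * (y b - mean K y))) * exp (- (q * pvar K y)) \<le> real K"
    by (simp add: exp_minus field_simps)
  have q_eq: "a\<^sup>2 / (2 * (1 - 2 * \<bar>a\<bar> * B / 3)) * v\<^sup>2 * pvar K y = q * pvar K y"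
    by (simp add: q_def)
  have "(\<Sum>b=1..K. exp (a * v * (y b - mean K y) - q * pvar K y)) =
      (\<Sum>b=1..K. exp (a * v * (y b - mean K y))) * exp (- (q * pvar K y))"
    by (simp add: sum_distrib_right mult_exp_exp)
  then show ?thesis
    unfolding q_eq using draw by simp
qed

section \<open>Drawing without replacement, last position first\<close>

lemma mean_cong: "(\<And>i. i \<in> {1..K} \<Longrightarrow> x i = y i) \<Longrightarrow> mean K x = mean K y"
  by (simp add: mean_def)

lemma pvar_cong: "(\<And>i. i \<in> {1..K} \<Longrightarrow> x i = y i) \<Longrightarrow> pvar K x = pvar K y"
  using mean_cong[of K x y] by (simp add: pvar_def)

lemma mean_permute: "p permutes {1..K} \<Longrightarrow> mean K (x \<circ> p) = mean K x"
  using sum.reindex_bij_betw[OF permutes_imp_bij, of p "{1..K}" x] by (simp add: mean_def)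

lemma pvar_permute: "p permutes {1..K} \<Longrightarrow> pvar K (x \<circ> p) = pvar K x"
  using sum.reindex_bij_betw[OF permutes_imp_bij, of p "{1..K}" "\<lambda>i. (x i - mean K x)\<^sup>2"]
  by (simp add: pvar_def mean_permute)

text \<open>
  Its exponential is a supermartingale for suitable \<open>c\<close>: when the population is drawn from the last position
  down to the first, the first \<open>k\<close> positions hold what is left before \<open>y k\<close> is drawn, so that
  \<open>mean k y\<close> and \<open>pvar k y\<close> are the conditional mean and variance of that draw.
\<close>

definition prefix_exponent :: "real \<Rightarrow> real \<Rightarrow> nat \<Rightarrow> (nat \<Rightarrow> real) \<Rightarrow> (nat \<Rightarrow> real) \<Rightarrow> real" where
  "prefix_exponent a c N v y =
     (\<Sum>k=1..N. a * v k * (y k - mean k y) - c * (v k)\<^sup>2 * pvar k y)"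

text \<open>
  The conditional expectation argument becomes an induction on the population size: a permutation is
  determined by the value \<open>b\<close> that it puts in the last position and by a permutation of the others.
  Mean and variance of the full population do not depend on the order, so the last summand is a
  function of \<open>b\<close> alone. The bound for the other summands holds for each \<open>b\<close>, and \<open>b\<close> itself is one
  draw.
\<close>

lemma prefix_exponent_Bernstein:
  assumes "\<And>i. i \<in> {1..N} \<Longrightarrow> x i \<in> {-1..1}" "\<And>k. k \<in> {1..N} \<Longrightarrow> \<bar>v k\<bar> \<le> B"
    and aB: "2 * \<bar>a\<bar> * B / 3 < 1"
  shows "perm_avg {1..N} (\<lambda>p. exp (prefix_exponent a (a\<^sup>2 / (2 * (1 - 2 * \<bar>a\<bar> * B / 3))) N v (x \<circ> p))) \<le> 1"
  using assms(1,2)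
proof (induction N arbitrary: x)
  case 0
  then show ?case
    by (simp add: perm_avg_def prefix_exponent_def)
next
  case (Suc N)
  define c where "c = a\<^sup>2 / (2 * (1 - 2 * \<bar>a\<bar> * B / 3))"
  define T where "T b = a * v (Suc N) * (x b - mean (Suc N) x) - c * (v (Suc N))\<^sup>2 * pvar (Suc N) x" for b
  have fixed_last: "(\<Sum>q | q permutes {1..N}.
        exp (prefix_exponent a c (Suc N) v (x \<circ> (Transposition.transpose (Suc N) b \<circ> q)))) \<le> fact N * exp (T b)"
    if b: "b \<in> {1..Suc N}" for b
  proof -
    define y where "y = x \<circ> Transposition.transpose (Suc N) b"
    have swap: "Transposition.transpose (Suc N) b permutes {1..Suc N}"
      using b by (intro permutes_swap_id) auto
    have y: "y i \<in> {-1..1}" if "i \<in> {1..Suc N}" for i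
      using permutes_in_image[OF swap, of i] Suc.prems(1) that unfolding y_def comp_def by blast
    have split: "exp (prefix_exponent a c (Suc N) v (x \<circ> (Transposition.transpose (Suc N) b \<circ> q))) =
        exp (prefix_exponent a c N v (y \<circ> q)) * exp (T b)" if q: "q permutes {1..N}" for q
    proof -
      have p: "Transposition.transpose (Suc N) b \<circ> q permutes {1..Suc N}"
        using permutes_compose[OF permutes_subset[OF q, of "{1..Suc N}"] swap] by auto
      have "q (Suc N) = Suc N"
        using permutes_not_in[OF q, of "Suc N"] by simp
      then have "(x \<circ> (Transposition.transpose (Suc N) b \<circ> q)) (Suc N) = x b"
        by simp
      then show ?thesis
        unfolding exp_add[symmetric] prefix_exponent_def T_def
        by (simp add: mean_permute[OF p] pvar_permute[OF p] y_def comp_assoc del: comp_apply)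
    qed
    have "(\<Sum>q | q permutes {1..N}. exp (prefix_exponent a c N v (y \<circ> q))) \<le> fact N"
      using Suc.IH[of y] Suc.prems(2) y
      unfolding perm_avg_def c_def[symmetric] by (simp add: divide_le_eq del: comp_apply)
    then show ?thesis
      by (simp add: split sum_distrib_right[symmetric] mult_right_mono del: comp_apply)
  qed
  have "(\<Sum>p | p permutes {1..Suc N}. exp (prefix_exponent a c (Suc N) v (x \<circ> p))) =
      (\<Sum>b=1..Suc N. \<Sum>q | q permutes {1..N}.
        exp (prefix_exponent a c (Suc N) v (x \<circ> (Transposition.transpose (Suc N) b \<circ> q))))"
    using sum_over_permutations_insert[of "{1..N}" "Suc N"
        "\<lambda>p. exp (prefix_exponent a c (Suc N) v (x \<circ> p))"]
    by (simp add: atLeastAtMostSuc_conv del: comp_apply)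
  also have "\<dots> \<le> (\<Sum>b=1..Suc N. fact N * exp (T b))"
    by (intro sum_mono fixed_last)
  also have "\<dots> = fact N * (\<Sum>b=1..Suc N. exp (T b))"
    by (simp only: sum_distrib_left)
  also have "\<dots> \<le> fact N * real (Suc N)"
    unfolding T_def c_def using Suc.prems aB
    by (intro mult_left_mono one_draw_Bernstein[where B = B]) auto
  finally show ?case
    unfolding c_def[symmetric] by (simp add: perm_avg_def mult.commute del: comp_apply)
qed

section \<open>Prefix averages in a random order\<close>

lemma harm_bounds:
  assumes "2 \<le> N"
  shows "1 < (harm N :: real)" "harm N < real N"
proof -
  have "harm N \<ge> (harm 2 :: real)"
    by (rule harm_mono) (fact assms)
  then show "1 < (harm N :: real)"
    by (simp add: harm_def numeral_2_eq_2)
  show "harm N < real N"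
    using assms
  proof (induction N rule: dec_induct)
    case base
    then show ?case by (simp add: harm_def numeral_2_eq_2)
  next
    case (step m)
    then show ?case
      using step by (simp add: harm_Suc) (smt (verit) inverse_le_1_iff of_nat_0_le_iff)
  qed
qed

lemma eps_pos: "2 \<le> N \<Longrightarrow> 0 < eps N"
  using harm_bounds[of N] by (simp add: eps_def)

lemma inverse_one_plus_eps:
  assumes "2 \<le> N"
  shows "1 / (1 + eps N) = (real N - harm N) / (real N - 1)"
    "eps N / (1 + eps N) = (harm N - 1) / (real N - 1)"
proof -
  note harm = harm_bounds[OF assms]
  have one: "1 + eps N = (real N - 1) / (real N - harm N)"
    using harm by (simp add: eps_def add_divide_eq_iff)
  show "1 / (1 + eps N) = (real N - harm N) / (real N - 1)"
    unfolding one by simp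
  show "eps N / (1 + eps N) = (harm N - 1) / (real N - 1)"
    unfolding one using harm by (simp add: eps_def)
qed

text \<open>
  In a random order, the average of \<open>h\<close> over the first \<open>k\<close> positions gives weight \<open>1 / k\<close> to position
  \<open>k\<close> itself and weight \<open>(k - 1) / k\<close> to a uniform choice among the other elements. Summing
  \<open>1 / k\<close> over all positions produces the harmonic number, hence \<open>eps N\<close>. The lemma is applied
  with the centred population as \<open>h\<close> to the linear part of the exponent, and with the squares of the
  centred population to the variances.
\<close>

lemma sum_perm_avg_prefix_mean:
  fixes g h :: "nat \<Rightarrow> real"
  assumes "2 \<le> N"
  shows "(\<Sum>k=1..N. perm_avg {1..N} (\<lambda>p. g (p k) * ((\<Sum>j=1..k. h (p j)) / real k))) =
     (eps N * (\<Sum>i=1..N. g i * h i) + (\<Sum>i=1..N. g i) * (\<Sum>i=1..N. h i) / real N) / (1 + eps N)"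
proof -
  define P where "P = (\<Sum>i=1..N. g i * h i) / real N"
  define Q where "Q = ((\<Sum>i=1..N. g i) * (\<Sum>i=1..N. h i) - (\<Sum>i=1..N. g i * h i)) / (real N * (real N - 1))"
  have prefix: "perm_avg {1..N} (\<lambda>p. g (p k) * ((\<Sum>j=1..k. h (p j)) / real k)) =
      (P - Q) * inverse (real k) + Q" if k: "k \<in> {1..N}" for k
  proof -
    have "{1..k} = insert k {1..<k}"
      using k by auto
    then have "(\<Sum>j=1..k. perm_avg {1..N} (\<lambda>p. g (p k) * h (p j))) =
        perm_avg {1..N} (\<lambda>p. g (p k) * h (p k)) + (\<Sum>j=1..<k. perm_avg {1..N} (\<lambda>p. g (p k) * h (p j)))"
      by simp
    also have "\<dots> = P + (\<Sum>j=1..<k. Q)"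
      using perm_avg_eval[of "{1..N}" k "\<lambda>i. g i * h i"] k
      by (intro arg_cong2[where f = "(+)"] sum.cong) (auto simp: P_def Q_def perm_avg_eval_two)
    also have "\<dots> = P + (real k - 1) * Q"
      using k by (simp add: of_nat_diff)
    finally have pair: "(\<Sum>j=1..k. perm_avg {1..N} (\<lambda>p. g (p k) * h (p j))) = P + (real k - 1) * Q" .
    have "perm_avg {1..N} (\<lambda>p. g (p k) * ((\<Sum>j=1..k. h (p j)) / real k)) =
        inverse (real k) * (\<Sum>j=1..k. perm_avg {1..N} (\<lambda>p. g (p k) * h (p j)))"
      by (simp add: perm_avg_sum[symmetric] perm_avg_cmult[symmetric] sum_distrib_left divide_inverse mult_ac)
    also have "\<dots> = (P - Q) * inverse (real k) + Q"
      unfolding pair using k by (simp add: field_simps)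
    finally show ?thesis .
  qed
  have "(\<Sum>k=1..N. perm_avg {1..N} (\<lambda>p. g (p k) * ((\<Sum>j=1..k. h (p j)) / real k))) =
      (\<Sum>k=1..N. (P - Q) * inverse (real k) + Q)"
    by (intro sum.cong refl prefix)
  also have "\<dots> = (P - Q) * harm N + real N * Q"
    by (simp add: sum.distrib harm_def sum_distrib_left)
  also have "\<dots> = (\<Sum>i=1..N. g i * h i) * ((harm N - 1) / (real N - 1)) +
      (\<Sum>i=1..N. g i) * (\<Sum>i=1..N. h i) / real N * ((real N - harm N) / (real N - 1))"
  proof -
    define S where "S = (\<Sum>i=1..N. g i * h i)"
    define R where "R = (\<Sum>i=1..N. g i) * (\<Sum>i=1..N. h i)"
    define d where "d = real N - 1"
    have N: "real N = d + 1" "d > 0"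
      using assms by (auto simp: d_def)
    show ?thesis
      unfolding P_def Q_def S_def[symmetric] R_def[symmetric] N(1) using N(2)
      by (simp add: divide_simps) algebra
  qed
  finally show ?thesis
    unfolding inverse_one_plus_eps[OF assms, symmetric]
    by (simp add: add_divide_distrib mult.commute)
qed

text \<open>
  The centred weighted sum is, up to the factor \<open>1 + eps N\<close>, the average over all orders of the
  martingale sum. Since a centred population has sum zero, only the diagonal term of
  \<open>sum_perm_avg_prefix_mean\<close> survives.
\<close>

lemma sum_perm_avg_prefix_deviation:
  assumes "2 \<le> N"
  shows "(\<Sum>k=1..N. perm_avg {1..N} (\<lambda>p. w (p k) * (y (p k) - mean k (y \<circ> p)))) =
    (\<Sum>i=1..N. w i * (y i - mean N y)) / (1 + eps N)"
proof -
  define h where "h i = y i - mean N y" for i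
  have sum_h: "(\<Sum>i=1..N. h i) = 0"
    unfolding h_def using assms by (intro sum_diff_mean) auto
  have centre: "w (p k) * (y (p k) - mean k (y \<circ> p)) = w (p k) * h (p k) - w (p k) * ((\<Sum>j=1..k. h (p j)) / real k)"
    if "k \<in> {1..N}" for k and p :: "nat \<Rightarrow> nat"
  proof -
    have "(\<Sum>j=1..k. h (p j)) / real k = mean k (y \<circ> p) - mean N y"
      using that by (simp add: h_def mean_def sum_subtractf diff_divide_distrib)
    then show ?thesis
      unfolding right_diff_distrib[symmetric] by (simp add: h_def)
  qed
  have "(\<Sum>k=1..N. perm_avg {1..N} (\<lambda>p. w (p k) * (y (p k) - mean k (y \<circ> p)))) =
      (\<Sum>k=1..N. perm_avg {1..N} (\<lambda>p. w (p k) * h (p k)) -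
        perm_avg {1..N} (\<lambda>p. w (p k) * ((\<Sum>j=1..k. h (p j)) / real k)))"
    unfolding perm_avg_diff[symmetric] by (intro sum.cong refl perm_avg_cong centre)
  also have "\<dots> = (\<Sum>k=1..N. (\<Sum>i=1..N. w i * h i) / real N) -
      eps N * (\<Sum>i=1..N. w i * h i) / (1 + eps N)"
    unfolding sum_subtractf sum_perm_avg_prefix_mean[OF assms] sum_h
    using perm_avg_eval[of "{1..N}" _ "\<lambda>i. w i * h i"] by simp
  also have "\<dots> = (\<Sum>i=1..N. w i * h i) / (1 + eps N)"
    using assms eps_pos[OF assms] by (simp add: field_simps)
  finally show ?thesis
    by (simp add: h_def)
qed

lemma pvar_le_centered:
  assumes "1 \<le> K"
  shows "pvar K z \<le> (\<Sum>j=1..K. (z j - m)\<^sup>2) / real K"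
proof -
  have "(\<Sum>j=1..K. (z j - m)\<^sup>2) = (\<Sum>j=1..K. (z j - mean K z)\<^sup>2 +
      2 * (mean K z - m) * (z j - mean K z) + (mean K z - m)\<^sup>2)"
    by (intro sum.cong refl) (simp add: power2_eq_square algebra_simps)
  also have "\<dots> = (\<Sum>j=1..K. (z j - mean K z)\<^sup>2) + real K * (mean K z - m)\<^sup>2"
    unfolding sum.distrib sum_distrib_left[symmetric] sum_diff_mean[OF assms] by simp
  finally show ?thesis
    unfolding pvar_def by (intro divide_right_mono) auto
qed

text \<open>
  Replacing the mean of each prefix by the mean of the whole population can only increase the sum of
  squares, and makes it an average of the fixed function \<open>h\<close>. Its diagonal term pairs the weight with
  the squared deviation of the same element; that square is at most \<open>2\<^sup>2 = 4\<close>, which is the origin of the inflation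
  \<open>4 * eps N\<close> of the variance.
\<close>

lemma sum_perm_avg_prefix_pvar:
  assumes "2 \<le> N" and y: "\<And>i. i \<in> {1..N} \<Longrightarrow> y i \<in> {-1..1}"
  shows "(\<Sum>k=1..N. perm_avg {1..N} (\<lambda>p. (w (p k))\<^sup>2 * pvar k (y \<circ> p))) \<le>
    (pvar N y + 4 * eps N) * (\<Sum>i=1..N. (w i)\<^sup>2) / (1 + eps N)"
proof -
  define h where "h i = (y i - mean N y)\<^sup>2" for i
  have sum_h: "(\<Sum>i=1..N. h i) = real N * pvar N y"
    using assms(1) by (simp add: h_def pvar_def)
  have h_le: "h i \<le> 4" if "i \<in> {1..N}" for i
  proof -
    have "\<bar>y i - mean N y\<bar> \<le> 2"
      using y[OF that] abs_mean_le_one[of N y] assms by fastforce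
    then have "(y i - mean N y)\<^sup>2 \<le> 2\<^sup>2"
      using power_mono[of "\<bar>y i - mean N y\<bar>" 2 2] by simp
    then show ?thesis
      by (simp add: h_def)
  qed
  have "(\<Sum>k=1..N. perm_avg {1..N} (\<lambda>p. (w (p k))\<^sup>2 * pvar k (y \<circ> p))) \<le>
      (\<Sum>k=1..N. perm_avg {1..N} (\<lambda>p. (w (p k))\<^sup>2 * ((\<Sum>j=1..k. h (p j)) / real k)))"
    using pvar_le_centered[of _ "y \<circ> _" "mean N y"]
    by (intro sum_mono perm_avg_mono mult_left_mono) (auto simp: h_def)
  also have "\<dots> = (eps N * (\<Sum>i=1..N. (w i)\<^sup>2 * h i) + (\<Sum>i=1..N. (w i)\<^sup>2) * pvar N y) / (1 + eps N)"
    unfolding sum_perm_avg_prefix_mean[OF assms(1), of "\<lambda>i. (w i)\<^sup>2" h] sum_h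
    using assms(1) by simp
  also have "\<dots> \<le> (eps N * (\<Sum>i=1..N. (w i)\<^sup>2 * 4) + (\<Sum>i=1..N. (w i)\<^sup>2) * pvar N y) / (1 + eps N)"
    using eps_pos[OF assms(1)] h_le
    by (intro divide_right_mono add_right_mono mult_left_mono sum_mono) auto
  also have "\<dots> = (pvar N y + 4 * eps N) * (\<Sum>i=1..N. (w i)\<^sup>2) / (1 + eps N)"
    unfolding sum_distrib_right[symmetric] by (simp add: algebra_simps)
  finally show ?thesis .
qed

section \<open>The Bernstein bound for a random permutation\<close>

text \<open>
  Rescaling by \<open>1 + eps N\<close> compensates the loss in \<open>sum_perm_avg_prefix_deviation\<close>. The coefficient
  of the variances is quadratic in \<open>a\<close> and hence acquires \<open>(1 + eps N)\<^sup>2\<close>, but the bound for the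
  averaged variances is smaller by one such factor, which is why only one remains.
\<close>

lemma le_perm_avg_prefix_exponent:
  fixes t B :: real
  assumes "2 \<le> N" and y: "\<And>i. i \<in> {1..N} \<Longrightarrow> y i \<in> {-1..1}"
    and tB: "2 * \<bar>t\<bar> / 3 * B * (1 + eps N) < 1"
  defines "a \<equiv> t * (1 + eps N)"
  shows "t * (\<Sum>i=1..N. w i * (y i - mean N y)) -
       t\<^sup>2 * (1 + eps N) / (2 * (1 - 2 * \<bar>t\<bar> / 3 * B * (1 + eps N))) *
         (pvar N y + 4 * eps N) * (\<Sum>i=1..N. (w i)\<^sup>2)
    \<le> perm_avg {1..N} (\<lambda>q. prefix_exponent a (a\<^sup>2 / (2 * (1 - 2 * \<bar>a\<bar> * B / 3))) N (w \<circ> q) (y \<circ> q))"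
proof -
  have eps: "0 < eps N"
    by (rule eps_pos[OF assms(1)])
  have denom: "2 * \<bar>a\<bar> * B / 3 = 2 * \<bar>t\<bar> / 3 * B * (1 + eps N)"
    using eps by (simp add: a_def abs_mult)
  define c where "c = a\<^sup>2 / (2 * (1 - 2 * \<bar>a\<bar> * B / 3))"
  define V where "V = (pvar N y + 4 * eps N) * (\<Sum>i=1..N. (w i)\<^sup>2)"
  have c: "c = (1 + eps N) * (t\<^sup>2 * (1 + eps N) / (2 * (1 - 2 * \<bar>t\<bar> / 3 * B * (1 + eps N))))"
    unfolding c_def denom by (simp add: a_def power2_eq_square mult_ac)
  have "0 \<le> c"
    unfolding c_def denom using tB by (intro divide_nonneg_nonneg mult_nonneg_nonneg) auto
  then have "c * (\<Sum>k=1..N. perm_avg {1..N} (\<lambda>q. (w (q k))\<^sup>2 * pvar k (y \<circ> q))) \<le> c * (V / (1 + eps N))"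
    unfolding V_def using sum_perm_avg_prefix_pvar[where y = y and w = w, OF assms(1) y] by (intro mult_left_mono) auto
  also have "\<dots> = t\<^sup>2 * (1 + eps N) / (2 * (1 - 2 * \<bar>t\<bar> / 3 * B * (1 + eps N))) * V"
    unfolding c using eps by simp
  finally have quadratic: "c * (\<Sum>k=1..N. perm_avg {1..N} (\<lambda>q. (w (q k))\<^sup>2 * pvar k (y \<circ> q)))
    \<le> t\<^sup>2 * (1 + eps N) / (2 * (1 - 2 * \<bar>t\<bar> / 3 * B * (1 + eps N))) * V" .
  have linear: "a * (\<Sum>k=1..N. perm_avg {1..N} (\<lambda>q. w (q k) * (y (q k) - mean k (y \<circ> q)))) =
      t * (\<Sum>i=1..N. w i * (y i - mean N y))"
    unfolding sum_perm_avg_prefix_deviation[OF assms(1)] using eps by (simp add: a_def)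
  have "perm_avg {1..N} (\<lambda>q. prefix_exponent a c N (w \<circ> q) (y \<circ> q)) =
      a * (\<Sum>k=1..N. perm_avg {1..N} (\<lambda>q. w (q k) * (y (q k) - mean k (y \<circ> q)))) -
      c * (\<Sum>k=1..N. perm_avg {1..N} (\<lambda>q. (w (q k))\<^sup>2 * pvar k (y \<circ> q)))"
    by (simp add: prefix_exponent_def perm_avg_sum perm_avg_diff mult.assoc perm_avg_cmult
        sum_subtractf sum_distrib_left)
  with linear quadratic show ?thesis
    unfolding c_def V_def by (simp add: mult.assoc)
qed

text \<open>
  Jensen's inequality introduces a second permutation \<open>q\<close>, which reorders values and weights together.
  For fixed \<open>q\<close>, the composition \<open>p \<circ> q\<close> is again uniform, so the averages can be exchanged and the
  supermartingale bound applies to the reordered weights \<open>w \<circ> q\<close>.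
\<close>

lemma perm_avg_Bernstein:
  fixes t B :: real
  assumes "2 \<le> N" and x: "\<And>i. i \<in> {1..N} \<Longrightarrow> x i \<in> {-1..1}"
    and w: "\<And>i. i \<in> {1..N} \<Longrightarrow> \<bar>w i\<bar> \<le> B"
    and tB: "2 * \<bar>t\<bar> / 3 * B * (1 + eps N) < 1"
  shows "perm_avg {1..N} (\<lambda>p. exp (t * (\<Sum>i=1..N. w i * (x (p i) - mean N x)) -
       t\<^sup>2 * (1 + eps N) / (2 * (1 - 2 * \<bar>t\<bar> / 3 * B * (1 + eps N))) *
         (pvar N x + 4 * eps N) * (\<Sum>i=1..N. (w i)\<^sup>2))) \<le> 1"
proof -
  define a where "a = t * (1 + eps N)"
  define c where "c = a\<^sup>2 / (2 * (1 - 2 * \<bar>a\<bar> * B / 3))"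
  have aB: "2 * \<bar>a\<bar> * B / 3 < 1"
    using tB eps_pos[OF assms(1)] by (simp add: a_def abs_mult mult_ac)
  have "perm_avg {1..N} (\<lambda>p. exp (t * (\<Sum>i=1..N. w i * (x (p i) - mean N x)) -
       t\<^sup>2 * (1 + eps N) / (2 * (1 - 2 * \<bar>t\<bar> / 3 * B * (1 + eps N))) *
         (pvar N x + 4 * eps N) * (\<Sum>i=1..N. (w i)\<^sup>2))) \<le>
      perm_avg {1..N} (\<lambda>p. perm_avg {1..N} (\<lambda>q. exp (prefix_exponent a c N (w \<circ> q) (x \<circ> (p \<circ> q)))))"
  proof (rule perm_avg_mono)
    fix p assume p: "p permutes {1..N}"
    have "(x \<circ> p) i \<in> {-1..1}" if "i \<in> {1..N}" for i
      using x[of "p i"] permutes_in_image[OF p, of i] that by simp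
    from le_perm_avg_prefix_exponent[where y = "x \<circ> p" and w = w, OF assms(1) this tB]
    show "exp (t * (\<Sum>i=1..N. w i * (x (p i) - mean N x)) -
         t\<^sup>2 * (1 + eps N) / (2 * (1 - 2 * \<bar>t\<bar> / 3 * B * (1 + eps N))) *
           (pvar N x + 4 * eps N) * (\<Sum>i=1..N. (w i)\<^sup>2)) \<le>
        perm_avg {1..N} (\<lambda>q. exp (prefix_exponent a c N (w \<circ> q) (x \<circ> (p \<circ> q))))"
      unfolding mean_permute[OF p] pvar_permute[OF p] a_def[symmetric] c_def[symmetric] comp_assoc
      by (intro exp_perm_avg_le) auto
  qed
  also have "\<dots> = perm_avg {1..N} (\<lambda>q. perm_avg {1..N} (\<lambda>p. exp (prefix_exponent a c N (w \<circ> q) (x \<circ> (p \<circ> q)))))"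
    by (rule perm_avg_swap)
  also have "\<dots> = perm_avg {1..N} (\<lambda>q. perm_avg {1..N} (\<lambda>p. exp (prefix_exponent a c N (w \<circ> q) (x \<circ> p))))"
    by (intro perm_avg_cong perm_avg_compose[of _ _ "\<lambda>p. exp (prefix_exponent a c N (w \<circ> _) (x \<circ> p))"])
  also have "\<dots> \<le> perm_avg {1..N} (\<lambda>q. 1)"
  proof (rule perm_avg_mono)
    fix q assume q: "q permutes {1..N}"
    have "\<bar>(w \<circ> q) k\<bar> \<le> B" if "k \<in> {1..N}" for k
      using w[of "q k"] permutes_in_image[OF q, of k] that by simp
    from prefix_exponent_Bernstein[where v = "w \<circ> q" and x = x, OF x this aB]
    show "perm_avg {1..N} (\<lambda>p. exp (prefix_exponent a c N (w \<circ> q) (x \<circ> p))) \<le> 1"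
      unfolding c_def .
  qed
  finally show ?thesis
    by (simp add: perm_avg_const)
qed

text \<open>
  Markov's inequality for one well-chosen \<open>t\<close>. The hypothesis is the sub-gamma condition with variance
  factor \<open>A\<close> and scale \<open>b\<close>; since \<open>0 < A\<close>, the chosen \<open>t\<close> lies strictly below \<open>1 / b\<close> when \<open>0 < b\<close>.
\<close>

lemma exp_moment_imp_tail:
  fixes S :: "('i \<Rightarrow> 'i) \<Rightarrow> real" and A b L :: real
  assumes "finite I" "0 < A" "0 \<le> b" "0 < L"
    and moment: "\<And>t. 0 \<le> t \<Longrightarrow> b * t < 1 \<Longrightarrow>
      perm_avg I (\<lambda>p. exp (t * S p - t\<^sup>2 / (2 * (1 - b * t)) * A)) \<le> 1"
  shows "perm_avg I (\<lambda>p. of_bool (sqrt A * sqrt (2 * L) + b * L \<le> S p)) \<le> exp (- L)"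
proof -
  define r s where "r = sqrt A" and "s = sqrt (2 * L)"
  \<comment> \<open>with this \<open>t\<close>, the exponent at the threshold \<open>r * s + b * L\<close> is exactly \<open>L\<close>\<close>
  define t where "t = s / (r + b * s)"
  have rs: "0 < r" "0 < s" "A = r * r" "L = s * s / 2"
    using assms by (auto simp: r_def s_def)
  have pos: "0 < r + b * s"
    using rs assms by (intro add_pos_nonneg) auto
  have t: "0 \<le> t" "1 - b * t = r / (r + b * s)"
    using rs pos by (auto simp: t_def field_simps)
  have "0 < 1 - b * t"
    unfolding t(2) using rs pos by simp
  then have bt: "b * t < 1"
    by simp
  have exponent: "t * (r * s + b * L) - t\<^sup>2 / (2 * (1 - b * t)) * A = L"
  proof -
    have "t * (r * s + b * L) - t\<^sup>2 / (2 * (1 - b * t)) * A =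
        (s * (r * s + b * (s * s / 2)) - s * s * r / 2) / (r + b * s)"
      unfolding t(2) unfolding t_def rs(3,4) using rs(1) pos
      by (simp add: power2_eq_square diff_divide_distrib) (simp add: algebra_simps)
    also have "s * (r * s + b * (s * s / 2)) - s * s * r / 2 = L * (r + b * s)"
      unfolding rs(4) by (simp add: algebra_simps)
    finally show ?thesis
      using pos by simp
  qed
  have "perm_avg I (\<lambda>p. of_bool (r * s + b * L \<le> S p)) \<le>
      perm_avg I (\<lambda>p. exp (- L) * exp (t * S p - t\<^sup>2 / (2 * (1 - b * t)) * A))"
  proof (rule perm_avg_mono)
    fix p
    show "of_bool (r * s + b * L \<le> S p) \<le> exp (- L) * exp (t * S p - t\<^sup>2 / (2 * (1 - b * t)) * A)"
    proof (cases "r * s + b * L \<le> S p")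
      case True
      then have "t * (r * s + b * L) \<le> t * S p"
        using t(1) by (rule mult_left_mono)
      with exponent True show ?thesis
        by (simp add: mult_exp_exp)
    qed simp
  qed
  also have "\<dots> \<le> exp (- L)"
    unfolding perm_avg_cmult using moment[OF t(1) bt] by simp
  finally show ?thesis
    by (simp add: r_def s_def)
qed

text \<open>
  The optimal \<open>t\<close> depends on the variance of the population, and is admissible because that variance
  is constant under permutations. For random variables the variance is random, so the tail bound is
  derived here, for each fixed population, rather than from the bound on the expectation.
\<close>

lemma perm_avg_Bernstein_tail:
  fixes B L :: real
  assumes "2 \<le> N" and x: "\<And>i. i \<in> {1..N} \<Longrightarrow> x i \<in> {-1..1}"
    and w: "\<And>i. i \<in> {1..N} \<Longrightarrow> \<bar>w i\<bar> \<le> B"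
    and w_pos: "0 < (\<Sum>i=1..N. (w i)\<^sup>2)" and "0 < L"
  shows "perm_avg {1..N} (\<lambda>p. of_bool (
      sqrt (pvar N x + 4 * eps N) * sqrt (\<Sum>i=1..N. (w i)\<^sup>2) * sqrt (2 * (1 + eps N) * L)
        + 2 / 3 * B * (1 + eps N) * L \<le> (\<Sum>i=1..N. w i * (x (p i) - mean N x)))) \<le> exp (- L)"
proof -
  have eps: "0 < eps N"
    by (rule eps_pos[OF assms(1)])
  have var: "0 < pvar N x + 4 * eps N"
    using eps by (intro add_nonneg_pos) (auto simp: pvar_def intro!: divide_nonneg_nonneg sum_nonneg)
  have B: "0 \<le> B"
    using w[of 1] assms(1) by auto
  define A where "A = (1 + eps N) * ((pvar N x + 4 * eps N) * (\<Sum>i=1..N. (w i)\<^sup>2))"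
  define b where "b = 2 / 3 * B * (1 + eps N)"
  have A: "0 < A"
    using eps var w_pos by (simp add: A_def)
  have b: "0 \<le> b"
    using eps B by (simp add: b_def)
  have "perm_avg {1..N} (\<lambda>p. exp (t * (\<Sum>i=1..N. w i * (x (p i) - mean N x))
      - t\<^sup>2 / (2 * (1 - b * t)) * A)) \<le> 1" if "0 \<le> t" "b * t < 1" for t
  proof -
    have bt: "2 * \<bar>t\<bar> / 3 * B * (1 + eps N) = b * t"
      using that by (simp add: b_def)
    from perm_avg_Bernstein[where x = x and w = w and B = B and t = t, OF assms(1) x w] that(2)
    show ?thesis
      unfolding bt A_def by (simp add: mult_ac)
  qed
  from exp_moment_imp_tail[OF _ A b \<open>0 < L\<close> this]
  have "perm_avg {1..N} (\<lambda>p. of_bool (sqrt A * sqrt (2 * L) + b * L \<le>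
      (\<Sum>i=1..N. w i * (x (p i) - mean N x)))) \<le> exp (- L)"
    by simp
  moreover have "sqrt A * sqrt (2 * L) =
      sqrt (pvar N x + 4 * eps N) * sqrt (\<Sum>i=1..N. (w i)\<^sup>2) * sqrt (2 * (1 + eps N) * L)"
    by (simp only: A_def real_sqrt_mult ac_simps)
  ultimately show ?thesis
    by (simp add: b_def)
qed

section \<open>Transfer to exchangeable variables\<close>

text \<open>
  Exchangeability means that an expectation is unchanged when the variables are permuted, so it equals
  the expectation of the average over all permutations of the realised values.
\<close>

lemma (in prob_space) expectation_exchangeable_le:
  assumes "finite I" and X: "\<And>i. i \<in> I \<Longrightarrow> X i \<in> borel_measurable M"
    and exch: "exchangeable M I X"
    and f: "f \<in> borel_measurable (\<Pi>\<^sub>M i\<in>I. borel)"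
    and bound: "AE \<omega> in M. perm_avg I (\<lambda>p. f (\<lambda>i\<in>I. X (p i) \<omega>)) \<le> c" and "0 \<le> c"
  shows "expectation (\<lambda>\<omega>. f (\<lambda>i\<in>I. X i \<omega>)) \<le> c"
proof (cases "integrable M (\<lambda>\<omega>. f (\<lambda>i\<in>I. X i \<omega>))")
  \<comment> \<open>the expectation of a function that is not integrable is 0\<close>
  case False
  then show ?thesis
    using \<open>0 \<le> c\<close> by (simp add: not_integrable_integral_eq)
next
  case True
  have meas: "(\<lambda>\<omega>. \<lambda>i\<in>I. X (p i) \<omega>) \<in> measurable M (\<Pi>\<^sub>M i\<in>I. borel)" if "p permutes I" for p
    using X permutes_in_image[OF that] by (intro measurable_restrict) auto
  have law: "distr M (\<Pi>\<^sub>M i\<in>I. borel) (\<lambda>\<omega>. \<lambda>i\<in>I. X (p i) \<omega>) =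
      distr M (\<Pi>\<^sub>M i\<in>I. borel) (\<lambda>\<omega>. \<lambda>i\<in>I. X i \<omega>)" if "p permutes I" for p
    using exch that by (simp add: exchangeable_def)
  note id = meas[OF permutes_id, unfolded id_apply]
  have int: "integrable M (\<lambda>\<omega>. f (\<lambda>i\<in>I. X (p i) \<omega>))" if "p permutes I" for p
    using True integrable_distr_eq[OF id f] integrable_distr_eq[OF meas[OF that] f] law[OF that]
    by simp
  have eq: "expectation (\<lambda>\<omega>. f (\<lambda>i\<in>I. X (p i) \<omega>)) = expectation (\<lambda>\<omega>. f (\<lambda>i\<in>I. X i \<omega>))"
    if "p permutes I" for p
    using integral_distr[OF id f] integral_distr[OF meas[OF that] f] law[OF that] by simp
  have "expectation (\<lambda>\<omega>. f (\<lambda>i\<in>I. X i \<omega>)) =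
      perm_avg I (\<lambda>p. expectation (\<lambda>\<omega>. f (\<lambda>i\<in>I. X (p i) \<omega>)))"
    using perm_avg_cong[of I, OF eq] perm_avg_const[OF assms(1)] by simp
  also have "\<dots> = expectation (\<lambda>\<omega>. perm_avg I (\<lambda>p. f (\<lambda>i\<in>I. X (p i) \<omega>)))"
    unfolding perm_avg_def using int by (simp add: Bochner_Integration.integral_sum)
  also have "\<dots> \<le> expectation (\<lambda>\<omega>. c)"
    using int bound unfolding perm_avg_def
    by (intro integral_mono_AE integrable_divide Bochner_Integration.integrable_sum) auto
  finally show ?thesis
    by (simp add: prob_space)
qed

lemma borel_measurable_mean:
  "(\<lambda>x. mean N x) \<in> borel_measurable (\<Pi>\<^sub>M i\<in>{1..N}. borel)"
  unfolding mean_def by measurable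

lemma borel_measurable_pvar:
  "(\<lambda>x. pvar N x) \<in> borel_measurable (\<Pi>\<^sub>M i\<in>{1..N}. borel)"
  using borel_measurable_mean[of N] unfolding pvar_def by measurable

text \<open>
  What remains is to rewrite the statement in terms of the padded weights. The two claims are the two
  bounds for a random permutation; in the second one, \<open>max_norm n w \<noteq> 0\<close> provides a non-zero weight, which
  makes the variance factor of the Chernoff bound positive.
\<close>

theorem theorem6:
  fixes M :: "'a measure" and X :: "nat \<Rightarrow> 'a \<Rightarrow> real" and w :: "nat \<Rightarrow> real" and n N :: nat
  assumes "prob_space M"
    and "2 \<le> n" and "n \<le> N"
    and "\<And>i. i \<in> {1..N} \<Longrightarrow> X i \<in> borel_measurable M"
    and "\<And>i. i \<in> {1..N} \<Longrightarrow> AE \<omega> in M. X i \<omega> \<in> {-1..1}"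
    and "exchangeable M {1..N} X"
  shows "(\<forall>t::real. (max_norm n w \<noteq> 0 \<longrightarrow> \<bar>t\<bar> < 3 / (2 * max_norm n w * (1 + eps N))) \<longrightarrow>
            prob_space.expectation M (\<lambda>\<omega>.
              exp (t * (\<Sum>i=1..n. w i * (X i \<omega> - mean N (\<lambda>j. X j \<omega>)))
                   - t\<^sup>2 * (1 + eps N) / (2 * (1 - 2 * \<bar>t\<bar> / 3 * max_norm n w * (1 + eps N)))
                     * (sd_infl N (\<lambda>j. X j \<omega>))\<^sup>2 * (L2_set w {1..n})\<^sup>2)) \<le> 1)
       \<and> (max_norm n w \<noteq> 0 \<longrightarrow> (\<forall>\<delta>::real. 0 < \<delta> \<and> \<delta> < 1 \<longrightarrow>
            prob_space.prob M {\<omega> \<in> space M.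
              (\<Sum>i=1..n. w i * (X i \<omega> - mean N (\<lambda>j. X j \<omega>)))
                \<ge> sd_infl N (\<lambda>j. X j \<omega>) * L2_set w {1..n} * sqrt (2 * (1 + eps N) * ln (1 / \<delta>))
                  + 2 / 3 * max_norm n w * (1 + eps N) * ln (1 / \<delta>)} \<le> \<delta>))"
proof -
  interpret prob_space M by fact
  have N: "2 \<le> N" and n1: "1 \<in> {1..n}"
    using assms(2,3) by auto
  note eps = eps_pos[OF N]
  define B where "B = max_norm n w"
  have w_le: "\<bar>w i\<bar> \<le> B" if "i \<in> {1..n}" for i
    unfolding B_def max_norm_def using that by (intro Max_ge) auto
  have B: "0 \<le> B"
    using w_le[OF n1] by linarith
  \<comment> \<open>padding the weights with zeros lets them be permuted together with all \<open>N\<close> values\<close>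
  define v where "v i = (if i \<le> n then w i else 0)" for i
  have v_le: "\<bar>v i\<bar> \<le> B" if "i \<in> {1..N}" for i
    using that w_le[of i] B by (auto simp: v_def)
  have pad: "(\<Sum>i=1..n. F (w i) i) = (\<Sum>i=1..N. F (v i) i)" if "\<And>i. F 0 i = 0" for F :: "real \<Rightarrow> nat \<Rightarrow> real"
    using assms(3) that by (intro sum.mono_neutral_cong_left) (auto simp: v_def)
  have norm_v: "(L2_set w {1..n})\<^sup>2 = (\<Sum>i=1..N. (v i)\<^sup>2)" "L2_set w {1..n} = sqrt (\<Sum>i=1..N. (v i)\<^sup>2)"
    using pad[of "\<lambda>a i. a\<^sup>2"] by (simp_all add: L2_set_def sum_nonneg)
  have sd: "sd_infl N x = sqrt (pvar N x + 4 * eps N)" "(sd_infl N x)\<^sup>2 = pvar N x + 4 * eps N" for x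
    using eps by (auto simp: sd_infl_def pvar_def sum_nonneg)
  define S where "S x = (\<Sum>i=1..N. v i * (x i - mean N x))" for x
  have S: "(\<Sum>i=1..n. w i * (x i - mean N x)) = S x" for x
    unfolding S_def by (rule pad[of "\<lambda>a i. a * (x i - mean N x)"]) simp
  have S_meas: "S \<in> borel_measurable (\<Pi>\<^sub>M i\<in>{1..N}. borel)"
    using borel_measurable_mean[of N] unfolding S_def by measurable
  note meas = S_meas borel_measurable_pvar[of N]
  have restrict: "mean N (\<lambda>i\<in>{1..N}. x i) = mean N x" "pvar N (\<lambda>i\<in>{1..N}. x i) = pvar N x"
    "S (\<lambda>i\<in>{1..N}. x i) = S x" for x :: "nat \<Rightarrow> real"
    by (auto simp: S_def intro!: mean_cong pvar_cong sum.cong arg_cong2[where f = "(*)"] arg_cong2[where f = "(-)"])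
  have permute: "mean N (\<lambda>i. x (p i)) = mean N x" "pvar N (\<lambda>i. x (p i)) = pvar N x"
    "S (\<lambda>i. x (p i)) = (\<Sum>i=1..N. v i * (x (p i) - mean N x))" if "p permutes {1..N}" for x p
    using mean_permute[OF that, of x] pvar_permute[OF that, of x] by (simp_all add: S_def comp_def)
  have range: "AE \<omega> in M. \<forall>i\<in>{1..N}. X i \<omega> \<in> {-1..1}"
    using assms(5) by (intro AE_finite_allI) auto
  have transfer: "expectation (\<lambda>\<omega>. F (S (\<lambda>j. X j \<omega>)) (pvar N (\<lambda>j. X j \<omega>))) \<le> c"
    if F: "(\<lambda>x. F (S x) (pvar N x)) \<in> borel_measurable (\<Pi>\<^sub>M i\<in>{1..N}. borel)" and "0 \<le> c"
      and avg: "\<And>x. (\<And>i. i \<in> {1..N} \<Longrightarrow> x i \<in> {-1..1}) \<Longrightarrow>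
        perm_avg {1..N} (\<lambda>p. F (\<Sum>i=1..N. v i * (x (p i) - mean N x)) (pvar N x)) \<le> c"
    for F c
  proof -
    have "AE \<omega> in M. perm_avg {1..N} (\<lambda>p. F (S (\<lambda>i\<in>{1..N}. X (p i) \<omega>)) (pvar N (\<lambda>i\<in>{1..N}. X (p i) \<omega>))) \<le> c"
      using range
    proof eventually_elim
      case (elim \<omega>)
      have "perm_avg {1..N} (\<lambda>p. F (S (\<lambda>i\<in>{1..N}. X (p i) \<omega>)) (pvar N (\<lambda>i\<in>{1..N}. X (p i) \<omega>))) =
          perm_avg {1..N} (\<lambda>p. F (\<Sum>i=1..N. v i * (X (p i) \<omega> - mean N (\<lambda>j. X j \<omega>))) (pvar N (\<lambda>j. X j \<omega>)))"
        unfolding restrict using permute[of _ "\<lambda>j. X j \<omega>"] by (intro perm_avg_cong) simp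
      with avg[of "\<lambda>j. X j \<omega>"] elim show ?case
        by simp
    qed
    from expectation_exchangeable_le[OF _ assms(4,6) F this \<open>0 \<le> c\<close>]
    show ?thesis
      unfolding restrict by simp
  qed
  show ?thesis
    unfolding S B_def[symmetric] norm_v(1) sd(2)
  proof (intro conjI allI impI)
    fix t :: real
    assume t: "B \<noteq> 0 \<longrightarrow> \<bar>t\<bar> < 3 / (2 * B * (1 + eps N))"
    have tB: "2 * \<bar>t\<bar> / 3 * B * (1 + eps N) < 1"
    proof (cases "B = 0")
      case False
      then have "0 < 2 * B * (1 + eps N)"
        using B eps by simp
      with t False show ?thesis
        by (simp add: pos_less_divide_eq mult_ac)
    qed simp
    show "expectation (\<lambda>\<omega>. exp (t * S (\<lambda>j. X j \<omega>) - t\<^sup>2 * (1 + eps N) /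
        (2 * (1 - 2 * \<bar>t\<bar> / 3 * B * (1 + eps N))) * (pvar N (\<lambda>j. X j \<omega>) + 4 * eps N) * (\<Sum>i=1..N. (v i)\<^sup>2))) \<le> 1"
    proof (rule transfer)
      show "(\<lambda>x. exp (t * S x - t\<^sup>2 * (1 + eps N) / (2 * (1 - 2 * \<bar>t\<bar> / 3 * B * (1 + eps N))) *
          (pvar N x + 4 * eps N) * (\<Sum>i=1..N. (v i)\<^sup>2))) \<in> borel_measurable (\<Pi>\<^sub>M i\<in>{1..N}. borel)"
        using meas by measurable
    qed (use perm_avg_Bernstein[where w = v, OF N _ v_le tB] in auto)
  next
    fix \<delta> :: real
    assume "B \<noteq> 0" and \<delta>: "0 < \<delta> \<and> \<delta> < 1"
    define L where "L = ln (1 / \<delta>)"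
    have L: "0 < L" "exp (- L) = \<delta>"
      using \<delta> by (auto simp: L_def ln_div)
    have "B \<in> (\<lambda>i. \<bar>w i\<bar>) ` {1..n}"
      unfolding B_def max_norm_def using n1 by (intro Max_in) auto
    then obtain i where "i \<in> {1..n}" "w i \<noteq> 0"
      using \<open>B \<noteq> 0\<close> by auto
    then have v_pos: "0 < (\<Sum>i=1..N. (v i)\<^sup>2)"
      using assms(3) by (intro sum_pos2[of _ i]) (auto simp: v_def)
    define E where "E s q \<longleftrightarrow> sqrt (q + 4 * eps N) * sqrt (\<Sum>i=1..N. (v i)\<^sup>2) * sqrt (2 * (1 + eps N) * L)
        + 2 / 3 * B * (1 + eps N) * L \<le> s" for s q :: real
    have "expectation (\<lambda>\<omega>. of_bool (E (S (\<lambda>j. X j \<omega>)) (pvar N (\<lambda>j. X j \<omega>)))) \<le> \<delta>"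
    proof (rule transfer)
      show "(\<lambda>x. of_bool (E (S x) (pvar N x))) \<in> borel_measurable (\<Pi>\<^sub>M i\<in>{1..N}. borel)"
        using meas unfolding E_def linorder_not_less[symmetric] by measurable
      show "perm_avg {1..N} (\<lambda>p. of_bool (E (\<Sum>i=1..N. v i * (x (p i) - mean N x)) (pvar N x))) \<le> \<delta>"
        if "\<And>i. i \<in> {1..N} \<Longrightarrow> x i \<in> {-1..1}" for x
        using perm_avg_Bernstein_tail[where x = x and w = v, OF N that v_le v_pos L(1)] by (simp add: E_def L(2))
    qed (use \<delta> in simp)
    also have "expectation (\<lambda>\<omega>. of_bool (E (S (\<lambda>j. X j \<omega>)) (pvar N (\<lambda>j. X j \<omega>)))) =
        expectation (indicator {\<omega> \<in> space M. E (S (\<lambda>j. X j \<omega>)) (pvar N (\<lambda>j. X j \<omega>))})"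
      by (intro Bochner_Integration.integral_cong) (auto simp: indicator_def)
    also have "\<dots> = prob {\<omega> \<in> space M. E (S (\<lambda>j. X j \<omega>)) (pvar N (\<lambda>j. X j \<omega>))}"
      by simp (rule arg_cong[where f = prob], auto)
    finally show "prob {\<omega> \<in> space M. sd_infl N (\<lambda>j. X j \<omega>) * L2_set w {1..n} * sqrt (2 * (1 + eps N) * ln (1 / \<delta>))
        + 2 / 3 * B * (1 + eps N) * ln (1 / \<delta>) \<le> S (\<lambda>j. X j \<omega>)} \<le> \<delta>"
      unfolding E_def sd(1) norm_v(2) L_def .
  qed
qed

end
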